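(* Let $R$ be a commutative ring with identity and let $\{N_1,N_2,\ldots,N_k\}$, $k\ge 2$, be a collection of ideals of $R$ satisfying both the Chain condition and the Nilpotency condition. Assume that $2+N_1\in (R/N_1)^*$. Then the following hold. 1. For $a\in R$: $a+N_1\in q((R/N_1)^* )$ if and only if $a+N_1\subset q(R^* )$. 2. $|q(R^* )|=|N_1|\,|q((R/N_1)^* )|$. 3. If $a\in R$ and $a+N_1\in q((R/N_1)^* )$, then $$|s(a)|=|s(a+N_{k-1})|=\cdots=|s(a+N_1)|.$$ 4. If for each $i=1,2,\ldots,k-1$ there exists $\alpha_i$ such that $|s(a+N_i)|=\alpha_i$ for all $a+N_i\in q((R/N_i)^* )$, then for each $i=1,\ldots,k-1$ $$|(R/N_{i+1})^*|=\alpha_i\,|q((R/N_{i+1})^* )|.$$ In particular, $|R^*|=\alpha_{k-1}\,|q(R^* )|$.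
   Context: For a commutative ring $S$ with identity, $S^*$ is its group of units. An element $a\in S$ is a quadratic residue in $S$ if there is $x\in S$ with $x^2=a$. $q(S^* )$ denotes the set of elements of $S^*$ that are quadratic residues in $S$. For a quadratic residue $a\in S$, $s(a)=\{x\in S: x^2=a\}$ is its set of square roots in $S$; thus $s(a+N_i)$ is the set of square roots of the element $a+N_i$ in the ring $R/N_i$. $|X|$ denotes the cardinality of the set $X$. Chain condition: $\{0\}=N_k\subset N_{k-1}\subset\cdots\subset N_2\subset N_1\subset R$ (inclusions not required to be strict). Nilpotency condition: for $i=1,\ldots,k-1$ there exists an integer $t_i\ge 2$ such that $N_i^{t_i}\subset N_{i+1}$. *)

theory Defs
  imports "HOL-Algebra.Algebra"
begin

unbundle cardinal_syntax

definition quadratic_residue :: "('a, 'm) ring_scheme \<Rightarrow> 'a \<Rightarrow> bool" where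
  "quadratic_residue S a \<longleftrightarrow> a \<in> carrier S \<and> (\<exists>x\<in>carrier S. x [^]\<^bsub>S\<^esub> (2::nat) = a)"

definition unit_quadratic_residues :: "('a, 'm) ring_scheme \<Rightarrow> 'a set" where
  "unit_quadratic_residues S = {a \<in> Units S. quadratic_residue S a}"

definition square_roots :: "('a, 'm) ring_scheme \<Rightarrow> 'a \<Rightarrow> 'a set" where
  "square_roots S a = {x \<in> carrier S. x [^]\<^bsub>S\<^esub> (2::nat) = a}"

text \<open>
  The ideals are indexed by \<open>{1..k}\<close>; values of \<open>N\<close> outside this range are irrelevant.
  The inclusion of the first ideal in the ring is part of being an ideal.
\<close>

definition chain_condition :: "('a, 'm) ring_scheme \<Rightarrow> nat \<Rightarrow> (nat \<Rightarrow> 'a set) \<Rightarrow> bool" where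
  "chain_condition R k N \<longleftrightarrow> N k = {\<zero>\<^bsub>R\<^esub>} \<and> (\<forall>i\<in>{1..k-1}. N (i + 1) \<subseteq> N i)"

text \<open>
  \<^const>\<open>ideals_set\<close> is the semiring of ideals, whose multiplication is the product of
  ideals; so the power below is the usual power of an ideal.
\<close>

definition nilpotency_condition :: "('a, 'm) ring_scheme \<Rightarrow> nat \<Rightarrow> (nat \<Rightarrow> 'a set) \<Rightarrow> bool" where
  "nilpotency_condition R k N \<longleftrightarrow>
     (\<forall>i\<in>{1..k-1}. \<exists>t\<ge>2::nat. N i [^]\<^bsub>ideals_set R\<^esub> t \<subseteq> N (i + 1))"

end

theory Submission
  imports Defs
begin

text \<open>
  Each \<open>N i\<close> is a nil ideal, so an element of \<open>R\<close> is a unit as soon as its residue modulo \<open>N i\<close>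
  is one (\<open>1 - e\<close> is invertible for nilpotent \<open>e\<close>), and square roots of units lift uniquely:
  Newton's iteration \<open>x \<mapsto> x - (x\<^sup>2 - a) / (2 x)\<close> squares the nilpotent error \<open>x\<^sup>2 - a\<close> up to a
  factor. Hence reduction modulo \<open>N i\<close> is a bijection between the roots of a unit and the roots of
  its residue class. All root sets in the chain are compared with the one in \<open>R\<close> directly, so no
  argument is needed for the step from \<open>R / N (i + 1)\<close> to \<open>R / N i\<close>.
\<close>

section \<open>Square roots of units, and units counted by their squares\<close>

lemma (in cring) Units_of_square:
  assumes "x \<in> carrier R" "x [^] (2::nat) \<in> Units R"
  shows "x \<in> Units R"
  using assms unit_factor[of x x] by (simp add: numeral_2_eq_2)

lemma (in cring) square_roots_subset_Units:
  assumes "b \<in> unit_quadratic_residues R"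
  shows "square_roots R b \<subseteq> Units R"
  using assms Units_of_square unfolding unit_quadratic_residues_def square_roots_def by auto

lemma (in cring) square_in_unit_quadratic_residues:
  assumes "x \<in> Units R"
  shows "x [^] (2::nat) \<in> unit_quadratic_residues R"
proof -
  have "x [^] (2::nat) \<in> Units R"
    using assms by (simp add: numeral_2_eq_2 Units_closed)
  then show ?thesis
    using assms unfolding unit_quadratic_residues_def quadratic_residue_def by auto
qed

text \<open>Squaring maps the units onto the unit quadratic residues, and its fibre over
  \<open>b\<close> is the full root set of \<open>b\<close>, because every root of a unit is a unit.
  Fibres of one common size make the domain a product. Working with cardinals covers infinite rings
  as well.\<close>

lemma (in cring) card_of_Units_square_roots:
  fixes \<alpha> :: "'c rel"
  assumes "Card_order \<alpha>"
    and "\<And>b. b \<in> unit_quadratic_residues R \<Longrightarrow> |square_roots R b| =o \<alpha>"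
  shows "|Units R| =o \<alpha> *c |unit_quadratic_residues R|"
proof -
  let ?Q = "unit_quadratic_residues R"
  \<comment> \<open>The field of \<open>\<alpha>\<close> serves as the model fibre; one bijection
    onto the actual fibre is chosen for each \<open>b\<close>.\<close>
  have "\<exists>f. bij_betw f (Field \<alpha>) (square_roots R b)" if "b \<in> ?Q" for b
    using card_of_Field_ordIso[OF assms(1)] assms(2)[OF that] card_of_ordIso
      ordIso_symmetric ordIso_transitive by metis
  then obtain f where f: "\<And>b. b \<in> ?Q \<Longrightarrow> bij_betw (f b) (Field \<alpha>) (square_roots R b)"
    by metis
  have sq: "f b z \<in> square_roots R b" if "b \<in> ?Q" "z \<in> Field \<alpha>" for b z
    using f that bij_betwE by blast
  have "bij_betw (\<lambda>(z, b). f b z) (Field \<alpha> \<times> ?Q) (Units R)"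
    unfolding bij_betw_def
  proof
    have "z = z' \<and> b = b'"
      if "b \<in> ?Q" "z \<in> Field \<alpha>" "b' \<in> ?Q" "z' \<in> Field \<alpha>" "f b z = f b' z'" for b z b' z'
    proof -
      \<comment> \<open>The index \<open>b\<close> is recovered as the square of the common
        value.\<close>
      have "b = b'" using sq[of b z] sq[of b' z'] that by (simp add: square_roots_def)
      then show ?thesis using f[of b] that by (auto simp: bij_betw_def inj_on_def)
    qed
    then show "inj_on (\<lambda>(z, b). f b z) (Field \<alpha> \<times> ?Q)" by (auto simp: inj_on_def)
    show "(\<lambda>(z, b). f b z) ` (Field \<alpha> \<times> ?Q) = Units R"
    proof
      show "(\<lambda>(z, b). f b z) ` (Field \<alpha> \<times> ?Q) \<subseteq> Units R"
        using sq square_roots_subset_Units by fastforce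
      show "Units R \<subseteq> (\<lambda>(z, b). f b z) ` (Field \<alpha> \<times> ?Q)"
      proof
        fix x assume x: "x \<in> Units R"
        define b where "b = x [^] (2::nat)"
        have b: "b \<in> ?Q" using square_in_unit_quadratic_residues[OF x] by (simp add: b_def)
        have "x \<in> square_roots R b" using x by (auto simp: square_roots_def b_def)
        then obtain z where "z \<in> Field \<alpha>" "x = f b z"
          using f[OF b] by (auto simp: bij_betw_def)
        then show "x \<in> (\<lambda>(z, b). f b z) ` (Field \<alpha> \<times> ?Q)" using b by force
      qed
    qed
  qed
  then have "|Field \<alpha> \<times> ?Q| =o |Units R|" by (metis card_of_ordIso)
  then show ?thesis by (simp add: cprod_def Field_card_of ordIso_symmetric)
qed

section \<open>Nilpotent elements and units\<close>

lemma (in ring) nat_pow_eq_zero_mono: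
  assumes "x \<in> carrier R" "x [^] (m::nat) = \<zero>" "m \<le> n"
  shows "x [^] n = \<zero>"
  using assms nat_pow_mult[of x m "n - m"] by simp

text \<open>Since 1 - e^2 = (1 - e)(1 + e), a unit 1 - e^2 has the unit factor 1 - e. Raising the
  exponent from n to 2^n lets each passage from e to e^2 halve it, until e itself is zero; no
  geometric series is summed.\<close>

lemma (in cring) one_minus_nilpotent_Units:
  assumes "e \<in> carrier R" "e [^] (n::nat) = \<zero>"
  shows "\<one> \<ominus> e \<in> Units R"
proof -
  have "e [^] ((2::nat) ^ n) = \<zero>"
    using nat_pow_eq_zero_mono assms less_exp[of n] less_imp_le by blast
  then show ?thesis using assms(1)
  proof (induction n arbitrary: e)
    case 0
    then show ?case by (simp add: minus_eq)
  next
    case (Suc n)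
    have "(e \<otimes> e) [^] ((2::nat) ^ n) = \<zero>"
      using Suc.prems nat_pow_pow[of e 2 "2 ^ n"] by (simp add: numeral_2_eq_2)
    then have "\<one> \<ominus> e \<otimes> e \<in> Units R" using Suc by simp
    moreover have "\<one> \<ominus> e \<otimes> e = (\<one> \<ominus> e) \<otimes> (\<one> \<oplus> e)"
      using Suc.prems by algebra
    ultimately show ?case using Suc.prems unit_factor by (metis a_closed minus_closed one_closed)
  qed
qed

lemma (in cring) Units_minus_nilpotent:
  assumes "x \<in> Units R" "e \<in> carrier R" "e [^] (n::nat) = \<zero>"
  shows "x \<ominus> e \<in> Units R"
proof -
  have x: "x \<in> carrier R" "inv x \<in> carrier R" using assms by auto
  have "(inv x \<otimes> e) [^] n = \<zero>"
    using assms x by (simp add: nat_pow_distrib)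
  then have "\<one> \<ominus> inv x \<otimes> e \<in> Units R"
    using one_minus_nilpotent_Units assms x by blast
  then have "x \<otimes> (\<one> \<ominus> inv x \<otimes> e) \<in> Units R" using assms by blast
  \<comment> \<open>The identity is polynomial in \<open>x\<close>, \<open>inv x\<close> and
    \<open>e\<close>; the relation between \<open>x\<close> and \<open>inv x\<close> enters only
    afterwards.\<close>
  moreover have "x \<otimes> (\<one> \<ominus> inv x \<otimes> e) = x \<ominus> (x \<otimes> inv x) \<otimes> e"
    using assms(2) x by algebra
  ultimately show ?thesis using assms by simp
qed

section \<open>Reduction modulo a nil ideal\<close>

text \<open>The exponent may depend on the element: every later argument treats one nilpotent
  element at a time.\<close>

locale nil_ideal = cring R + ideal I R for I and R (structure) +
  assumes nil: "x \<in> I \<Longrightarrow> \<exists>n::nat. x [^] n = \<zero>"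
begin

lemma Quot_cring: "cring (R Quot I)"
  by (rule quotient_is_cring) (rule cring_axioms)

lemma Quot_hom: "(+>) I \<in> ring_hom R (R Quot I)"
  by (rule rcos_ring_hom)

lemma Quot_carrierE:
  assumes "C \<in> carrier (R Quot I)"
  obtains c where "c \<in> carrier R" "C = I +> c"
  using assms by (auto simp: FactRing_simps)

lemma coset_carrier: "a \<in> carrier R \<Longrightarrow> I +> a \<in> carrier (R Quot I)"
  by (rule ring_hom_closed[OF Quot_hom])

lemma coset_eq_iff:
  "a \<in> carrier R \<Longrightarrow> b \<in> carrier R \<Longrightarrow> I +> a = I +> b \<longleftrightarrow> a \<ominus> b \<in> I"
  using quotient_eq_iff_same_a_r_cos[OF ideal_axioms] by simp

lemma coset_square:
  "x \<in> carrier R \<Longrightarrow> (I +> x) [^]\<^bsub>R Quot I\<^esub> (2::nat) = I +> x [^] (2::nat)"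
  using ring_hom_mult[OF Quot_hom, of x x] ring.is_monoid[OF quotient_is_ring] coset_carrier
  by (simp add: numeral_2_eq_2 monoid.l_one)

lemma mem_coset:
  assumes "a \<in> carrier R" "b \<in> I +> a"
  shows "b \<in> carrier R" "I +> b = I +> a"
  using assms a_repr_independence'[of b a] a_elemrcos_carrier[of a b] by auto

text \<open>If \<open>b\<close> represents an inverse of the class of \<open>a\<close>, then 1 - ab
  lies in \<open>I\<close> and is nilpotent, so ab = 1 - (1 - ab) is a unit and so is its factor
  \<open>a\<close>. The converse is the image of an inverse under reduction.\<close>

lemma coset_Units_iff:
  assumes "a \<in> carrier R"
  shows "I +> a \<in> Units (R Quot I) \<longleftrightarrow> a \<in> Units R"
proof
  assume "I +> a \<in> Units (R Quot I)"
  then obtain C where "C \<in> carrier (R Quot I)" and C: "(I +> a) \<otimes>\<^bsub>R Quot I\<^esub> C = \<one>\<^bsub>R Quot I\<^esub>"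
    unfolding Units_def by auto
  then obtain b where b: "b \<in> carrier R" "C = I +> b" by (elim Quot_carrierE)
  have "I +> a \<otimes> b = I +> \<one>"
    using C b assms ring_hom_mult[OF Quot_hom, of a b] ring_hom_one[OF Quot_hom] by simp
  then have "\<one> \<ominus> a \<otimes> b \<in> I" using assms b coset_eq_iff[of \<one> "a \<otimes> b"] by simp
  then obtain n :: nat where "(\<one> \<ominus> a \<otimes> b) [^] n = \<zero>" using nil by auto
  then have "\<one> \<ominus> (\<one> \<ominus> a \<otimes> b) \<in> Units R"
    using one_minus_nilpotent_Units[of "\<one> \<ominus> a \<otimes> b" n] assms b by simp
  moreover have "\<one> \<ominus> (\<one> \<ominus> a \<otimes> b) = a \<otimes> b" using assms b by algebra
  ultimately show "a \<in> Units R" using assms b unit_factor[of a b] by simp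
next
  assume "a \<in> Units R"
  then obtain b where "b \<in> carrier R" "a \<otimes> b = \<one>" "b \<otimes> a = \<one>"
    unfolding Units_def by auto
  then have "(I +> a) \<otimes>\<^bsub>R Quot I\<^esub> (I +> b) = \<one>\<^bsub>R Quot I\<^esub>"
    "(I +> b) \<otimes>\<^bsub>R Quot I\<^esub> (I +> a) = \<one>\<^bsub>R Quot I\<^esub>"
    using assms ring_hom_mult[OF Quot_hom, of a b] ring_hom_mult[OF Quot_hom, of b a]
      ring_hom_one[OF Quot_hom] by simp_all
  then show "I +> a \<in> Units (R Quot I)"
    using assms \<open>b \<in> carrier R\<close> coset_carrier unfolding Units_def by auto
qed

lemma coset_unit_quadratic_residue:
  assumes "a \<in> unit_quadratic_residues R"
  shows "I +> a \<in> unit_quadratic_residues (R Quot I)"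
proof -
  from assms obtain x where "a \<in> Units R" "x \<in> carrier R" "x [^] (2::nat) = a"
    unfolding unit_quadratic_residues_def quadratic_residue_def by auto
  moreover from this have "I +> x \<in> carrier (R Quot I)" "(I +> x) [^]\<^bsub>R Quot I\<^esub> (2::nat) = I +> a"
    using coset_carrier coset_square by auto
  ultimately show ?thesis
    using coset_Units_iff[of a] coset_carrier[of a]
    unfolding unit_quadratic_residues_def quadratic_residue_def by blast
qed

section \<open>Lifting square roots by Newton's iteration\<close>

text \<open>An exponent of the form 2^n that kills the error is halved by each Newton step, which
  gives the induction. Every correction lies in \<open>I\<close>, so the final root keeps the
  residue class of \<open>x\<close>.\<close>

lemma square_root_lift:
  assumes two: "\<one> \<oplus> \<one> \<in> Units R" and a: "a \<in> carrier R"
    and x: "x \<in> Units R" and e: "x \<otimes> x \<ominus> a \<in> I"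
  obtains y where "y \<in> carrier R" "y \<otimes> y = a" "x \<ominus> y \<in> I"
proof -
  obtain n :: nat where n: "(x \<otimes> x \<ominus> a) [^] n = \<zero>" using nil[OF e] by auto
  have "(x \<otimes> x \<ominus> a) [^] ((2::nat) ^ n) = \<zero>"
    using nat_pow_eq_zero_mono[OF _ n] Icarr[OF e] less_exp[of n] less_imp_le by blast
  then have "\<exists>y\<in>carrier R. y \<otimes> y = a \<and> x \<ominus> y \<in> I" using x e
  proof (induction n arbitrary: x)
    \<comment> \<open>The exponent is 2^0 = 1, so the error vanishes and \<open>x\<close> itself is
      the root.\<close>
    case 0
    then have "x \<in> carrier R" by auto
    moreover have "x \<otimes> x \<ominus> a \<in> carrier R" using a \<open>x \<in> carrier R\<close> by simp
    then have "x \<otimes> x = a" using 0 a \<open>x \<in> carrier R\<close> by simp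
    moreover have "x \<ominus> x \<in> I" using \<open>x \<in> carrier R\<close> zero_closed by (simp add: minus_eq r_neg)
    ultimately show ?case by blast
  next
    case (Suc n)
    define e where "e = x \<otimes> x \<ominus> a"
    \<comment> \<open>With u = 1/(2x), the Newton correction is
      \<open>e \<otimes> u\<close>.\<close>
    define u where "u = inv ((\<one> \<oplus> \<one>) \<otimes> x)"
    have x: "x \<in> carrier R" using Suc.prems by auto
    have "(\<one> \<oplus> \<one>) \<otimes> x \<in> Units R" using two Suc.prems by auto
    then have u: "u \<in> carrier R" "(\<one> \<oplus> \<one>) \<otimes> x \<otimes> u = \<one>" by (simp_all add: u_def)
    have eI: "e \<in> I" and e: "e \<in> carrier R" using Suc.prems x a by (simp_all add: e_def)
    \<comment> \<open>The correction is nilpotent, so the new approximation remains a unit, as the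
      induction hypothesis demands.\<close>
    have euI: "e \<otimes> u \<in> I" using eI u I_r_closed by simp
    obtain m :: nat where "(e \<otimes> u) [^] m = \<zero>" using nil[OF euI] by auto
    then have y: "x \<ominus> e \<otimes> u \<in> Units R"
      using Units_minus_nilpotent Suc.prems(2) e u by simp
    define d where "d = e \<otimes> u"
    have d: "d \<in> carrier R" using e u by (simp add: d_def)
    have a_eq: "a = x \<otimes> x \<ominus> e" unfolding e_def using x a by algebra
    have "((\<one> \<oplus> \<one>) \<otimes> x) \<otimes> d = ((\<one> \<oplus> \<one>) \<otimes> x \<otimes> u) \<otimes> e"
      unfolding d_def using x e u(1) by algebra
    then have xd: "((\<one> \<oplus> \<one>) \<otimes> x) \<otimes> d = e" using u e by simp
    \<comment> \<open>The linear term 2xd equals \<open>e\<close> by the choice of \<open>d\<close>,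
      so only the square of the correction survives as the new error.\<close>
    have "(x \<ominus> d) \<otimes> (x \<ominus> d) \<ominus> (x \<otimes> x \<ominus> e) = (e \<ominus> ((\<one> \<oplus> \<one>) \<otimes> x) \<otimes> d) \<oplus> d \<otimes> d"
      using x e d by algebra
    also have "\<dots> = d \<otimes> d" unfolding xd using e d by (simp add: minus_eq r_neg)
    also have "\<dots> = (e \<otimes> e) \<otimes> (u \<otimes> u)" unfolding d_def using e u(1) by algebra
    finally have err: "(x \<ominus> e \<otimes> u) \<otimes> (x \<ominus> e \<otimes> u) \<ominus> a = (e \<otimes> e) \<otimes> (u \<otimes> u)"
      by (simp only: a_eq d_def)
    have "(e \<otimes> e) [^] ((2::nat) ^ n) = \<zero>"
      using Suc.prems(1) e nat_pow_pow[of e 2 "2 ^ n"] by (simp add: e_def[symmetric] numeral_2_eq_2)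
    then have "((e \<otimes> e) \<otimes> (u \<otimes> u)) [^] ((2::nat) ^ n) = \<zero>"
      using e u by (simp add: nat_pow_distrib)
    moreover have "(e \<otimes> e) \<otimes> (u \<otimes> u) \<in> I"
      using eI e u I_r_closed by simp
    ultimately obtain y where "y \<in> carrier R" "y \<otimes> y = a" and d: "(x \<ominus> e \<otimes> u) \<ominus> y \<in> I"
      using Suc.IH[OF _ y] err by auto
    moreover have "x \<ominus> y = ((x \<ominus> e \<otimes> u) \<ominus> y) \<oplus> e \<otimes> u"
      using x e u(1) \<open>y \<in> carrier R\<close> by algebra
    then have "x \<ominus> y \<in> I" using d euI by simp
    ultimately show ?case by blast
  qed
  then show ?thesis using that by blast
qed

text \<open>The sum x + y = 2x - (x - y) is a unit minus a nilpotent element, hence a unit, and it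
  can be cancelled from (x + y)(x - y) = 0.\<close>

lemma square_root_unique:
  assumes two: "\<one> \<oplus> \<one> \<in> Units R"
    and x: "x \<in> Units R" and y: "y \<in> carrier R"
    and "x \<otimes> x = y \<otimes> y" "x \<ominus> y \<in> I"
  shows "x = y"
proof -
  have xc: "x \<in> carrier R" using x by auto
  obtain n :: nat where n: "(x \<ominus> y) [^] n = \<zero>" using nil assms by blast
  have "(\<one> \<oplus> \<one>) \<otimes> x \<ominus> (x \<ominus> y) \<in> Units R"
    using Units_minus_nilpotent[OF _ _ n] two x xc y by simp
  moreover have "(\<one> \<oplus> \<one>) \<otimes> x \<ominus> (x \<ominus> y) = x \<oplus> y" using xc y by algebra
  ultimately have s: "x \<oplus> y \<in> Units R" by simp
  have "(x \<oplus> y) \<otimes> (x \<ominus> y) = x \<otimes> x \<ominus> y \<otimes> y" using xc y by algebra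
  then have "(x \<oplus> y) \<otimes> (x \<ominus> y) = (x \<oplus> y) \<otimes> \<zero>" using assms xc y by (simp add: minus_eq r_neg)
  then have "x \<ominus> y = \<zero>" using Units_l_cancel[OF s] xc y by blast
  then show ?thesis using xc y by simp
qed

section \<open>Unit quadratic residues and root sets under reduction\<close>

lemma coset_unit_quadratic_residue_iff:
  assumes two: "\<one> \<oplus> \<one> \<in> Units R" and a: "a \<in> carrier R"
  shows "I +> a \<in> unit_quadratic_residues (R Quot I) \<longleftrightarrow> a \<in> unit_quadratic_residues R"
proof
  assume q: "I +> a \<in> unit_quadratic_residues (R Quot I)"
  then have au: "a \<in> Units R" using a coset_Units_iff by (simp add: unit_quadratic_residues_def)
  obtain C where C: "C \<in> carrier (R Quot I)" "C [^]\<^bsub>R Quot I\<^esub> (2::nat) = I +> a"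
    using q unfolding unit_quadratic_residues_def quadratic_residue_def by auto
  from C(1) obtain x where "x \<in> carrier R" "C = I +> x" by (rule Quot_carrierE)
  then have x: "x \<in> carrier R" "(I +> x) [^]\<^bsub>R Quot I\<^esub> (2::nat) = I +> a" using C by simp_all
  have sq: "I +> x \<otimes> x = I +> a" using x coset_square[of x] by (simp add: numeral_2_eq_2)
  \<comment> \<open>Newton's iteration must start at a unit: \<open>x \<otimes> x\<close> has the
    class of the unit \<open>a\<close>, so it is a unit, and so is its factor
    \<open>x\<close>.\<close>
  then have "x \<otimes> x \<in> Units R" using coset_Units_iff[of "x \<otimes> x"] coset_Units_iff[OF a] au x by simp
  then have "x \<in> Units R" using x unit_factor[of x x] by simp
  moreover have "x \<otimes> x \<ominus> a \<in> I" using sq x a coset_eq_iff[of "x \<otimes> x" a] by simp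
  ultimately obtain y where "y \<in> carrier R" "y \<otimes> y = a"
    by (rule square_root_lift[OF two a])
  then show "a \<in> unit_quadratic_residues R"
    using au a unfolding unit_quadratic_residues_def quadratic_residue_def
    by (auto simp: numeral_2_eq_2)
qed (rule coset_unit_quadratic_residue)

text \<open>Injectivity is the uniqueness of a root within its class; surjectivity is Newton lifting
  from a representative of a root of the class.\<close>

lemma bij_betw_square_roots:
  assumes two: "\<one> \<oplus> \<one> \<in> Units R" and a: "a \<in> Units R"
  shows "bij_betw ((+>) I) (square_roots R a) (square_roots (R Quot I) (I +> a))"
  unfolding bij_betw_def
proof
  have ac: "a \<in> carrier R" using a by auto
  have unit: "x \<in> Units R" if "x \<in> carrier R" "x \<otimes> x = a" for x
    using that a unit_factor[of x x] by simp
  show "inj_on ((+>) I) (square_roots R a)"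
  proof (rule inj_onI)
    fix x y assume "x \<in> square_roots R a" "y \<in> square_roots R a" "I +> x = I +> y"
    then have "x \<in> carrier R" "y \<in> carrier R" "x \<otimes> x = a" "y \<otimes> y = a" "x \<ominus> y \<in> I"
      using coset_eq_iff[of x y] by (auto simp: square_roots_def numeral_2_eq_2)
    then show "x = y" using square_root_unique[OF two, of x y] unit by simp
  qed
  show "(+>) I ` square_roots R a = square_roots (R Quot I) (I +> a)"
  proof
    show "(+>) I ` square_roots R a \<subseteq> square_roots (R Quot I) (I +> a)"
      using coset_square coset_carrier by (auto simp: square_roots_def)
    show "square_roots (R Quot I) (I +> a) \<subseteq> (+>) I ` square_roots R a"
    proof
      fix C assume C: "C \<in> square_roots (R Quot I) (I +> a)"
      then obtain x where x: "x \<in> carrier R" "C = I +> x"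
        using Quot_carrierE by (auto simp: square_roots_def)
      have sq: "I +> x \<otimes> x = I +> a"
        using C x coset_square[of x] by (simp add: square_roots_def numeral_2_eq_2)
      then have "x \<otimes> x \<in> Units R" using coset_Units_iff[of "x \<otimes> x"] coset_Units_iff[OF ac] a x by simp
      then have "x \<in> Units R" using x unit_factor[of x x] by simp
      then obtain y where y: "y \<in> carrier R" "y \<otimes> y = a" "x \<ominus> y \<in> I"
        using square_root_lift[OF two ac] sq x ac coset_eq_iff[of "x \<otimes> x" a] by auto
      then have "y \<in> square_roots R a" by (simp add: square_roots_def numeral_2_eq_2)
      moreover have "C = I +> y" using x y coset_eq_iff by simp
      ultimately show "C \<in> (+>) I ` square_roots R a" by blast
    qed
  qed
qed

lemma card_of_square_roots_Quot:
  assumes "\<one> \<oplus> \<one> \<in> Units R" "a \<in> unit_quadratic_residues R"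
  shows "|square_roots R a| =o |square_roots (R Quot I) (I +> a)|"
  using bij_betw_square_roots assms card_of_ordIso unfolding unit_quadratic_residues_def by blast

text \<open>The unit quadratic residues of \<open>R\<close> form the union of the cosets that are
  unit quadratic residues modulo \<open>I\<close>. Each such coset \<open>C\<close> is the translate
  of \<open>I\<close> by a chosen representative \<open>r C\<close>.\<close>

lemma card_of_unit_quadratic_residues:
  assumes two: "\<one> \<oplus> \<one> \<in> Units R"
  shows "|unit_quadratic_residues R| =o |I| *c |unit_quadratic_residues (R Quot I)|"
proof -
  let ?Q = "unit_quadratic_residues (R Quot I)"
  have "\<exists>r. r \<in> carrier R \<and> I +> r = C" if "C \<in> ?Q" for C
  proof -
    have "C \<in> carrier (R Quot I)"
      using that by (simp add: unit_quadratic_residues_def quadratic_residue_def)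
    then show ?thesis by (elim Quot_carrierE) blast
  qed
  then obtain r where r: "\<And>C. C \<in> ?Q \<Longrightarrow> r C \<in> carrier R" "\<And>C. C \<in> ?Q \<Longrightarrow> I +> r C = C"
    by metis
  have coset: "I +> (n \<oplus> r C) = C" if "n \<in> I" "C \<in> ?Q" for n C
  proof -
    have "n \<oplus> r C \<in> I +> r C" using that r by (auto simp: a_r_coset_def')
    then show ?thesis using mem_coset(2) r that by metis
  qed
  have "bij_betw (\<lambda>(n, C). n \<oplus> r C) (I \<times> ?Q) (unit_quadratic_residues R)"
    unfolding bij_betw_def
  proof
    have "n = n' \<and> C = C'"
      if h: "n \<in> I" "C \<in> ?Q" "n' \<in> I" "C' \<in> ?Q" "n \<oplus> r C = n' \<oplus> r C'" for n C n' C'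
    proof -
      \<comment> \<open>Reduction recovers the class from the sum; cancelling the representative
        then recovers the element of \<open>I\<close>.\<close>
      have "C = C'" using coset h by metis
      then show ?thesis using h r(1) Icarr add.r_cancel by auto
    qed
    then show "inj_on (\<lambda>(n, C). n \<oplus> r C) (I \<times> ?Q)" by (auto simp: inj_on_def)
    show "(\<lambda>(n, C). n \<oplus> r C) ` (I \<times> ?Q) = unit_quadratic_residues R"
    proof
      have "n \<oplus> r C \<in> unit_quadratic_residues R" if "n \<in> I" "C \<in> ?Q" for n C
        using coset[OF that] that r(1) Icarr coset_unit_quadratic_residue_iff[OF two, of "n \<oplus> r C"]
        by simp
      then show "(\<lambda>(n, C). n \<oplus> r C) ` (I \<times> ?Q) \<subseteq> unit_quadratic_residues R" by auto
      show "unit_quadratic_residues R \<subseteq> (\<lambda>(n, C). n \<oplus> r C) ` (I \<times> ?Q)"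
      proof
        fix a assume aq: "a \<in> unit_quadratic_residues R"
        then have a: "a \<in> carrier R" by (auto simp: unit_quadratic_residues_def)
        have C: "I +> a \<in> ?Q" by (rule coset_unit_quadratic_residue[OF aq])
        have "a \<in> I +> r (I +> a)" using r(2)[OF C] a_rcos_self[OF a] by simp
        then obtain n where "n \<in> I" "a = n \<oplus> r (I +> a)" by (auto simp: a_r_coset_def')
        then show "a \<in> (\<lambda>(n, C). n \<oplus> r C) ` (I \<times> ?Q)" using C by force
      qed
    qed
  qed
  then have "|I \<times> ?Q| =o |unit_quadratic_residues R|" by (metis card_of_ordIso)
  then show ?thesis by (simp add: cprod_def Field_card_of ordIso_symmetric)
qed

end

section \<open>Nilpotency along the chain of ideals\<close>

lemma (in ring) pow_mem_ideal_pow: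
  assumes "I \<subseteq> carrier R" "x \<in> I"
  shows "x [^] (n::nat) \<in> I [^]\<^bsub>ideals_set R\<^esub> n"
proof (induction n)
  case 0
  then show ?case by (simp add: ideals_set_def)
next
  case (Suc n)
  then show ?case using assms by (simp add: ideals_set_def ideal_prod.prod)
qed

text \<open>A suitable power of an element of \<open>N i\<close> lies in \<open>N (i + 1)\<close>.
  Repeating this leads to \<open>N k\<close>, the zero ideal, and the exponents multiply.\<close>

lemma (in ring) chain_nil:
  assumes ideals: "\<And>i. i \<in> {1..k} \<Longrightarrow> ideal (N i) R"
    and "chain_condition R k N" "nilpotency_condition R k N"
    and "i \<in> {1..k}" "x \<in> N i"
  shows "\<exists>n::nat. x [^] n = \<zero>"
proof -
  have "i \<le> k" using assms by simp
  \<comment> \<open>The induction descends from \<open>k\<close>; the guard keeps the index in the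
    range where both conditions speak about \<open>N\<close>.\<close>
  then have "1 \<le> i \<longrightarrow> (\<forall>x\<in>N i. \<exists>n::nat. x [^] n = \<zero>)"
  proof (induction i rule: inc_induct)
    case base
    have "N k = {\<zero>}" using assms(2) by (simp add: chain_condition_def)
    \<comment> \<open>The exponent is 1, since the zeroth power would be the identity.\<close>
    moreover have "\<exists>n::nat. \<zero> [^] n = \<zero>" by (rule exI[of _ 1]) simp
    ultimately show ?case by simp
  next
    case (step i)
    show ?case
    proof (intro impI ballI)
      fix x assume "1 \<le> i" "x \<in> N i"
      then have "i \<in> {1..k-1}" using step.hyps by simp
      then have "\<exists>t\<ge>2::nat. N i [^]\<^bsub>ideals_set R\<^esub> t \<subseteq> N (i + 1)"
        using assms(3) unfolding nilpotency_condition_def by blast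
      then obtain t :: nat where t: "N i [^]\<^bsub>ideals_set R\<^esub> t \<subseteq> N (Suc i)" by auto
      have "i \<in> {1..k}" using \<open>1 \<le> i\<close> step.hyps by simp
      then have sub: "N i \<subseteq> carrier R"
        by (intro subsetI ideal.Icarr[OF ideals])
      have "x [^] t \<in> N (Suc i)" using pow_mem_ideal_pow[OF sub \<open>x \<in> N i\<close>] t by (rule subsetD[rotated])
      then obtain n :: nat where "(x [^] t) [^] n = \<zero>" using step.IH by force
      then have "x [^] (t * n) = \<zero>" using nat_pow_pow[of x t n] sub \<open>x \<in> N i\<close> by auto
      then show "\<exists>n::nat. x [^] n = \<zero>" by (rule exI)
    qed
  qed
  then show ?thesis using assms(4,5) by simp
qed

section \<open>Comparison of the quotients through \<open>R\<close>\<close>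

theorem theorem3p5:
  fixes R :: "('a, 'm) ring_scheme" (structure)
    and N :: "nat \<Rightarrow> 'a set"
    and k :: nat
    and \<alpha> :: "nat \<Rightarrow> 'b rel"
  assumes "cring R"
    and "k \<ge> 2"
    and "\<And>i. i \<in> {1..k} \<Longrightarrow> ideal (N i) R"
    and "chain_condition R k N"
    and "nilpotency_condition R k N"
    and "N 1 +> (\<one> \<oplus> \<one>) \<in> Units (R Quot N 1)"
  shows
    "(\<forall>a\<in>carrier R.
        N 1 +> a \<in> unit_quadratic_residues (R Quot N 1)
          \<longleftrightarrow> N 1 +> a \<subseteq> unit_quadratic_residues R)
   \<and> |unit_quadratic_residues R| =o |N 1| *c |unit_quadratic_residues (R Quot N 1)|
   \<and> (\<forall>a\<in>carrier R.
        N 1 +> a \<in> unit_quadratic_residues (R Quot N 1) \<longrightarrow>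
          |square_roots R a| =o |square_roots (R Quot N (k-1)) (N (k-1) +> a)|
          \<and> (\<forall>i\<in>{1..<k-1}. |square_roots (R Quot N (i+1)) (N (i+1) +> a)|
                              =o |square_roots (R Quot N i) (N i +> a)| ))
   \<and> ((\<forall>i\<in>{1..k-1}. Card_order (\<alpha> i) \<and>
          (\<forall>a\<in>carrier R. N i +> a \<in> unit_quadratic_residues (R Quot N i) \<longrightarrow>
             |square_roots (R Quot N i) (N i +> a)| =o \<alpha> i)) \<longrightarrow>
        (\<forall>i\<in>{1..k-1}. |Units (R Quot N (i+1))|
                         =o \<alpha> i *c |unit_quadratic_residues (R Quot N (i+1))| )
        \<and> |Units R| =o \<alpha> (k-1) *c |unit_quadratic_residues R| )"
proof -
  interpret R: cring R by fact
  have nil: "nil_ideal (N i) R" if "i \<in> {1..k}" for i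
    by (intro nil_ideal.intro nil_ideal_axioms.intro assms(1) assms(3)[OF that]
        R.chain_nil[of k N i, OF assms(3-5) that])
  interpret N1: nil_ideal "N 1" R using nil assms(2) by simp
  \<comment> \<open>Invertibility of 2 is lifted from the quotient by \<open>N 1\<close> to
    \<open>R\<close>, where it serves all the ideals \<open>N i\<close> at once.\<close>
  have two: "\<one> \<oplus> \<one> \<in> Units R" using N1.coset_Units_iff assms(6) by simp
  have roots: "|square_roots R a| =o |square_roots (R Quot N i) (N i +> a)|"
    if "i \<in> {1..k}" "a \<in> unit_quadratic_residues R" for i a
    using nil_ideal.card_of_square_roots_Quot[OF nil two] that by blast
  have lift: "N i +> a \<in> unit_quadratic_residues (R Quot N i) \<longleftrightarrow> a \<in> unit_quadratic_residues R"
    if "i \<in> {1..k}" "a \<in> carrier R" for i a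
    using nil_ideal.coset_unit_quadratic_residue_iff[OF nil two] that by blast
  have 1: "N 1 +> a \<in> unit_quadratic_residues (R Quot N 1)
      \<longleftrightarrow> N 1 +> a \<subseteq> unit_quadratic_residues R" if a: "a \<in> carrier R" for a
  proof
    assume q: "N 1 +> a \<in> unit_quadratic_residues (R Quot N 1)"
    show "N 1 +> a \<subseteq> unit_quadratic_residues R"
    proof
      fix b assume "b \<in> N 1 +> a"
      \<comment> \<open>All elements of the coset share one residue class, so the criterion for a
        single element applies to each of them.\<close>
      then have "b \<in> carrier R" "N 1 +> b = N 1 +> a" using N1.mem_coset[OF a] by blast+
      then show "b \<in> unit_quadratic_residues R"
        using q N1.coset_unit_quadratic_residue_iff[OF two, of b] by simp
    qed
  next
    assume "N 1 +> a \<subseteq> unit_quadratic_residues R"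
    then have "a \<in> unit_quadratic_residues R" using N1.a_rcos_self[OF a] by blast
    then show "N 1 +> a \<in> unit_quadratic_residues (R Quot N 1)"
      by (rule N1.coset_unit_quadratic_residue)
  qed
  have 3: "|square_roots R a| =o |square_roots (R Quot N (k-1)) (N (k-1) +> a)|
      \<and> (\<forall>i\<in>{1..<k-1}. |square_roots (R Quot N (i+1)) (N (i+1) +> a)|
                          =o |square_roots (R Quot N i) (N i +> a)| )"
    if "a \<in> carrier R" "N 1 +> a \<in> unit_quadratic_residues (R Quot N 1)" for a
  proof -
    have a: "a \<in> unit_quadratic_residues R"
      using that N1.coset_unit_quadratic_residue_iff[OF two] by blast
    have "|square_roots (R Quot N (i+1)) (N (i+1) +> a)| =o |square_roots (R Quot N i) (N i +> a)|"
      if i: "i \<in> {1..<k-1}" for i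
    proof -
      have "i \<in> {1..k}" "i + 1 \<in> {1..k}" using i by auto
      then show ?thesis using roots[OF _ a] ordIso_symmetric ordIso_transitive by blast
    qed
    moreover have "k - 1 \<in> {1..k}" using assms(2) by auto
    ultimately show ?thesis using roots[OF _ a] by blast
  qed
  have 4: "(\<forall>i\<in>{1..k-1}. |Units (R Quot N (i+1))|
                         =o \<alpha> i *c |unit_quadratic_residues (R Quot N (i+1))| )
        \<and> |Units R| =o \<alpha> (k-1) *c |unit_quadratic_residues R|"
    if \<alpha>: "\<forall>i\<in>{1..k-1}. Card_order (\<alpha> i) \<and>
          (\<forall>a\<in>carrier R. N i +> a \<in> unit_quadratic_residues (R Quot N i) \<longrightarrow>
             |square_roots (R Quot N i) (N i +> a)| =o \<alpha> i)"
  proof -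
    \<comment> \<open>The constant \<open>\<alpha> i\<close>, given modulo \<open>N i\<close>, is
      transported to \<open>R\<close>, from where it can be carried to any other quotient of the
      chain.\<close>
    have rootsR: "|square_roots R a| =o \<alpha> i"
      if i: "i \<in> {1..k-1}" and a: "a \<in> unit_quadratic_residues R" for i a
    proof -
      have ik: "i \<in> {1..k}" using i by auto
      have ac: "a \<in> carrier R" using a by (auto simp: unit_quadratic_residues_def)
      then have "|square_roots (R Quot N i) (N i +> a)| =o \<alpha> i" using \<alpha> i lift[OF ik ac] a by blast
      then show ?thesis using roots[OF ik a] ordIso_transitive by blast
    qed
    have "|Units (R Quot N (i+1))| =o \<alpha> i *c |unit_quadratic_residues (R Quot N (i+1))|"
      if i: "i \<in> {1..k-1}" for i
    proof -
      have ik: "i + 1 \<in> {1..k}" using i by auto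
      interpret J: nil_ideal "N (i + 1)" R by (rule nil[OF ik])
      interpret S: cring "R Quot N (i + 1)" by (rule J.Quot_cring)
      show ?thesis
      proof (rule S.card_of_Units_square_roots)
        show "Card_order (\<alpha> i)" using \<alpha> i by blast
        fix B assume B: "B \<in> unit_quadratic_residues (R Quot N (i + 1))"
        then have "B \<in> carrier (R Quot N (i + 1))"
          by (simp add: unit_quadratic_residues_def quadratic_residue_def)
        then obtain b where b: "b \<in> carrier R" "B = N (i + 1) +> b" by (rule J.Quot_carrierE)
        then have bq: "b \<in> unit_quadratic_residues R" using B lift[OF ik] by blast
        show "|square_roots (R Quot N (i + 1)) B| =o \<alpha> i"
          \<comment> \<open>The roots modulo \<open>N (i + 1)\<close> are matched with those of the
            representative \<open>b\<close> in \<open>R\<close>, and these number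
            \<open>\<alpha> i\<close>.\<close>
          using ordIso_transitive[OF ordIso_symmetric[OF roots[OF ik bq]] rootsR[OF i bq]] b
          by simp
      qed
    qed
    moreover have "|Units R| =o \<alpha> (k-1) *c |unit_quadratic_residues R|"
    \<comment> \<open>The count is made in \<open>R\<close> itself with the index
      \<open>k - 1\<close>, which avoids identifying \<open>R\<close> with its quotient by
      \<open>N k\<close>.\<close>
    proof (rule R.card_of_Units_square_roots)
      have k: "k - 1 \<in> {1..k-1}" using assms(2) by auto
      show "Card_order (\<alpha> (k-1))" using \<alpha> k by blast
      show "|square_roots R b| =o \<alpha> (k-1)" if "b \<in> unit_quadratic_residues R" for b
        by (rule rootsR[OF k that])
    qed
    ultimately show ?thesis by blast
  qed
  show ?thesis
    by (rule conjI, rule ballI, erule 1, rule conjI, rule N1.card_of_unit_quadratic_residues[OF two],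
        rule conjI, rule ballI, rule impI, erule (1) 3, rule impI, erule 4)
qed

end
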